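(* Let $\sigma_a(x):=\frac12+\frac1\pi\arctan(x)$, $r\in\mathbb{N}$, and $1\le p\le\infty$. For each abstract modulus of smoothness $\omega$ satisfying $\lim_{\delta\to0+}\omega(\delta)/\delta=\infty$ there exists $f_\omega\in X^p[0,1]$ such that $$\omega_r(f_\omega,\delta)_p=O(\omega(\delta^r))\ (\delta\to0+)\quad\text{and}\quad E(\Phi_{n,\sigma_a},f_\omega)_p\ne o\Big(\omega\Big(\frac1{n^r}\Big)\Big)\ (n\to\infty).$$
   Context: $\mathbb{N}=\{1,2,\dots\}$. $X^\infty[0,1]:=C[0,1]$ with $\|f\|_{X^\infty[0,1]}:=\sup_{x\in[0,1]}|f(x)|$, and $X^p[0,1]:=L^p[0,1]$ with $\|f\|_{X^p[0,1]}:=(\int_0^1|f(x)|^p\,dx)^{1/p}$ for $1\le p<\infty$. For $\sigma:\mathbb{R}\to\mathbb{R}$, $\Phi_{n,\sigma}:=\{g:[0,1]\to\mathbb{R}: g(x)=\sum_{k=1}^n a_k\sigma(b_kx+c_k),\ a_k,b_k,c_k\in\mathbb{R}\}$ and $E(\Phi_{n,\sigma},f)_p:=\inf\{\|f-g\|_{X^p[0,1]}:g\in\Phi_{n,\sigma}\}$. With $\Delta_h^rf(x):=\sum_{j=0}^r(-1)^{r-j}\binom rj f(x+jh)$, the $r$th moduli of smoothness are $\omega_r(f,\delta)_\infty:=\sup\{|\Delta_h^rf(x)|:x\in[0,1-rh],\,0<h\le\delta\}$ and $\omega_r(f,\delta)_p:=\sup\{(\int_0^{1-rh}|\Delta_h^rf(x)|^p\,dx)^{1/p}:0<h\le\delta\}$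 for $1\le p<\infty$ (only step sizes with $rh\le1$ contribute). An abstract modulus of smoothness is a continuous, increasing (non-decreasing) function $\omega$ on $[0,\infty)$ with $0=\omega(0)<\omega(\delta_1)\le\omega(\delta_1+\delta_2)\le\omega(\delta_1)+\omega(\delta_2)$ for all $\delta_1,\delta_2>0$. *)

theory Defs
  imports "HOL-Analysis.Analysis" "HOL-Library.Landau_Symbols"
begin

text \<open>
  Functions on \<open>[0,1]\<close> are represented by functions of type \<^typ>\<open>real \<Rightarrow> real\<close>; membership in
  the spaces, the norms and the moduli only depend on the values on \<open>[0,1]\<close>. Elements of \<open>L^p[0,1]\<close> are given by
  representatives. The exponent \<open>p\<close> ranges over \<open>[1,\<infinity>]\<close>; for \<open>p = \<infinity>\<close> the space is \<open>C[0,1]\<close>,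
  not the space of essentially bounded functions.
\<close>

definition X_space :: "ennreal \<Rightarrow> (real \<Rightarrow> real) set" where
  "X_space p =
    (if p = \<infinity> then {f. continuous_on {0..1} f}
     else {f. f \<in> borel_measurable (lebesgue_on {0..1}) \<and>
              integrable (lebesgue_on {0..1}) (\<lambda>x. \<bar>f x\<bar> powr enn2real p)})"

definition X_norm :: "ennreal \<Rightarrow> (real \<Rightarrow> real) \<Rightarrow> real" where
  "X_norm p f =
    (if p = \<infinity> then (SUP x\<in>{0..1}. \<bar>f x\<bar>)
     else (\<integral>x. \<bar>f x\<bar> powr enn2real p \<partial>lebesgue_on {0..1}) powr (1 / enn2real p))"

definition Phi :: "nat \<Rightarrow> (real \<Rightarrow> real) \<Rightarrow> (real \<Rightarrow> real) set" where
  "Phi n \<sigma> = {g. \<exists>a b c :: nat \<Rightarrow> real. \<forall>x\<in>{0..1}. g x = (\<Sum>k=1..n. a k * \<sigma> (b k * x + c k))}"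

text \<open>
  The norm is real-valued, so \<open>best_approx\<close> has its intended meaning when \<open>f\<close> and all
  members of \<open>Phi n \<sigma>\<close> lie in \<open>X_space p\<close>, for example for \<open>f\<close> in \<open>X_space p\<close> and
  continuous \<open>\<sigma>\<close>.
\<close>

definition best_approx :: "(real \<Rightarrow> real) set \<Rightarrow> (real \<Rightarrow> real) \<Rightarrow> ennreal \<Rightarrow> real" where
  "best_approx G f p = (INF g\<in>G. X_norm p (\<lambda>x. f x - g x))"

definition fwd_diff :: "nat \<Rightarrow> real \<Rightarrow> (real \<Rightarrow> real) \<Rightarrow> real \<Rightarrow> real" where
  "fwd_diff r h f x = (\<Sum>j=0..r. (-1) ^ (r - j) * real (r choose j) * f (x + real j * h))"

text \<open>
  Only steps with \<open>r h \<le> 1\<close> are admitted. For \<open>f\<close> in \<open>X_space p\<close> and \<open>\<delta> > 0\<close> the suprema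
  are over nonempty bounded sets.
\<close>

definition smoothness_modulus :: "nat \<Rightarrow> (real \<Rightarrow> real) \<Rightarrow> real \<Rightarrow> ennreal \<Rightarrow> real" where
  "smoothness_modulus r f \<delta> p =
    (if p = \<infinity> then
       Sup {\<bar>fwd_diff r h f x\<bar> | x h. 0 < h \<and> h \<le> \<delta> \<and> real r * h \<le> 1 \<and> x \<in> {0..1 - real r * h}}
     else
       Sup {(\<integral>x. \<bar>fwd_diff r h f x\<bar> powr enn2real p \<partial>lebesgue_on {0..1 - real r * h})
              powr (1 / enn2real p) | h. 0 < h \<and> h \<le> \<delta> \<and> real r * h \<le> 1})"

definition abstract_modulus :: "(real \<Rightarrow> real) \<Rightarrow> bool" where
  "abstract_modulus \<omega> \<longleftrightarrow>
     continuous_on {0..} \<omega> \<and> mono_on {0..} \<omega> \<and> \<omega> 0 = 0 \<and>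
     (\<forall>\<delta>1>0. \<forall>\<delta>2>0. 0 < \<omega> \<delta>1 \<and> \<omega> \<delta>1 \<le> \<omega> (\<delta>1 + \<delta>2) \<and> \<omega> (\<delta>1 + \<delta>2) \<le> \<omega> \<delta>1 + \<omega> \<delta>2)"

definition sigma_a :: "real \<Rightarrow> real" where
  "sigma_a x = 1 / 2 + 1 / pi * arctan x"

end

theory Submission
  imports Defs
begin

text \<open>
  One continuous function serves all exponents \<open>p\<close> at once, namely a lacunary series
  \<open>f x = (\<Sum>k. a k * sin (4 * pi * 4 r N\<^sub>k * x))\<close> with \<open>a k = \<omega> (1 / N\<^sub>k ^ r)\<close>. The sup norm dominates
  every \<open>L^p\<close> norm on a set of measure at most one and the \<open>L^1\<close> norm is dominated by every norm
  considered, so the smoothness is estimated in the sup norm and the approximation error in \<open>L^1\<close>.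

  Smoothness. The growth condition on \<open>\<omega> \<delta> / \<delta>\<close> and the continuity of \<open>\<omega>\<close> at zero allow a choice of
  \<open>N\<^sub>k\<close> for which \<open>a k\<close> decays and \<open>N\<^sub>k ^ r * a k\<close> grows at least geometrically, with any
  prescribed ratio \<open>K\<close> (\<open>lacunary_frequencies\<close>). The \<open>k\<close>-th summand has \<open>r\<close>-th differences of size
  at most a constant times \<open>a k * min 1 ((N\<^sub>k h) ^ r)\<close>. Both the summands with \<open>N\<^sub>k h < 1\<close> and those
  with \<open>N\<^sub>k h \<ge> 1\<close> are therefore controlled by the one next to the threshold, which is
  \<open>O (\<omega> (h ^ r))\<close> because \<open>\<omega>\<close> is increasing and \<open>\<omega> t / t\<close> is almost decreasing
  (\<open>abs_fwd_diff_series_le\<close>).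

  Approximation error. The \<open>r\<close>-th derivative of a sum of \<open>n\<close> scaled arcus tangens functions is a
  rational function whose numerator has degree at most \<open>2 r n\<close>
  (\<open>network_iterated_derivative\<close>). Hence on at least half of \<open>L = 4 r n\<close> equal subintervals
  of \<open>[0,1]\<close> the derivative, and with it every \<open>r\<close>-th difference of the network, has a constant sign
  (\<open>network_fwd_diff_sign\<close>). For \<open>n = N\<^sub>k\<close> each subinterval carries two periods of the \<open>k\<close>-th sine,
  so on one full period the differences of that sine take both signs and a function of
  constant sign misses them by a multiple of \<open>a k\<close> in the mean. The remaining summands of \<open>f\<close> have
  differences that are small against \<open>a k\<close> when \<open>K\<close> is large. As \<open>r\<close>-th differences are bounded in
  \<open>L^1\<close> by \<open>2 ^ r\<close> times the function, the error at \<open>n = N\<^sub>k\<close> is at least a constant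
  multiple of \<open>\<omega> (1 / n ^ r)\<close>.
\<close>

section \<open>Forward differences\<close>

text \<open>
  Pascal's rule. This recursion turns every inductive argument on the order of the difference into one
  about the function \<open>\<lambda>y. f (y + h) - f y\<close>.
\<close>
lemma fwd_diff_Suc:
  "fwd_diff (Suc r) h f x = fwd_diff r h (\<lambda>y. f (y + h) - f y) x"
proof -
  have pascal: "(\<Sum>j=0..Suc r. (-1) ^ (Suc r - j) * real (Suc r choose j) * F j)
      = (\<Sum>j=0..r. (-1) ^ (r - j) * real (r choose j) * F (Suc j))
        - (\<Sum>j=0..r. (-1) ^ (r - j) * real (r choose j) * F j)" for F :: "nat \<Rightarrow> real"
  proof -
    have eq: "(-1) ^ (r - j) * real (r choose Suc j) * F (Suc j)
        = - ((-1) ^ (r - Suc j) * real (r choose Suc j) * F (Suc j))" if "j \<le> r" for j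
    proof (cases "j = r")
      case False
      then have "r - j = Suc (r - Suc j)" using that by simp
      then show ?thesis by simp
    qed simp
    have "(\<Sum>j=0..Suc r. (-1) ^ (Suc r - j) * real (Suc r choose j) * F j)
        = (-1) ^ Suc r * F 0
          + (\<Sum>j=0..r. (-1) ^ (r - j) * real (Suc r choose Suc j) * F (Suc j))"
      by (subst sum.atLeast0_atMost_Suc_shift) simp
    also have "(\<Sum>j=0..r. (-1) ^ (r - j) * real (Suc r choose Suc j) * F (Suc j))
        = (\<Sum>j=0..r. (-1) ^ (r - j) * real (r choose j) * F (Suc j))
        + (\<Sum>j=0..r. (-1) ^ (r - j) * real (r choose Suc j) * F (Suc j))"
      by (simp add: sum.distrib[symmetric] algebra_simps)
    also have "(\<Sum>j=0..r. (-1) ^ (r - j) * real (r choose Suc j) * F (Suc j))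
        = - (\<Sum>j=0..r. (-1) ^ (r - Suc j) * real (r choose Suc j) * F (Suc j))"
      unfolding sum_negf[symmetric] by (rule sum.cong) (use eq in auto)
    also have "(\<Sum>j=0..r. (-1) ^ (r - Suc j) * real (r choose Suc j) * F (Suc j))
        = (\<Sum>j=0..Suc r. (-1) ^ (r - j) * real (r choose j) * F j) - (-1) ^ r * F 0"
    proof -
      have "(\<Sum>j=0..Suc r. (-1) ^ (r - j) * real (r choose j) * F j)
          = (-1) ^ r * F 0 + (\<Sum>j=0..r. (-1) ^ (r - Suc j) * real (r choose Suc j) * F (Suc j))"
        by (subst sum.atLeast0_atMost_Suc_shift) simp
      then show ?thesis by simp
    qed
    finally show ?thesis by simp
  qed
  show ?thesis
    unfolding fwd_diff_def pascal[of "\<lambda>j. f (x + real j * h)"]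
    by (simp add: sum_subtractf[symmetric] algebra_simps)
qed

lemma fwd_diff_0 [simp]: "fwd_diff 0 h f x = f x"
  by (simp add: fwd_diff_def)

lemma fwd_diff_diff:
  "fwd_diff r h (\<lambda>x. f x - g x) x = fwd_diff r h f x - fwd_diff r h g x"
  by (simp add: fwd_diff_def sum_subtractf[symmetric] algebra_simps)

lemma fwd_diff_scale: "fwd_diff r h (\<lambda>x. c * f x) x = c * fwd_diff r h f x"
  by (simp add: fwd_diff_def sum_distrib_left mult_ac)

lemma fwd_diff_suminf:
  fixes f :: "nat \<Rightarrow> real \<Rightarrow> real"
  assumes "\<And>x. summable (\<lambda>k. f k x)"
  shows "(\<lambda>k. fwd_diff r h (f k) x) sums fwd_diff r h (\<lambda>x. \<Sum>k. f k x) x"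
  unfolding fwd_diff_def
  by (intro sums_sum sums_mult summable_sums assms)

lemma abs_fwd_diff_le:
  "\<bar>fwd_diff r h f x\<bar> \<le> (\<Sum>j=0..r. real (r choose j) * \<bar>f (x + real j * h)\<bar>)"
  unfolding fwd_diff_def
  by (rule order_trans[OF sum_abs]) (simp add: abs_mult power_abs)

lemma sum_binomial_mult: "(\<Sum>j=0..r. real (r choose j) * B) = 2 ^ r * B"
  by (simp add: sum_distrib_right[symmetric] of_nat_sum[symmetric] choose_row_sum
      atLeast0AtMost del: of_nat_sum)

lemma abs_fwd_diff_bounded:
  assumes "\<And>x. \<bar>f x\<bar> \<le> B"
  shows "\<bar>fwd_diff r h f x\<bar> \<le> 2 ^ r * B"
proof -
  have "\<bar>fwd_diff r h f x\<bar> \<le> (\<Sum>j=0..r. real (r choose j) * B)"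
    by (rule order_trans[OF abs_fwd_diff_le sum_mono]) (intro mult_left_mono assms, simp)
  also have "\<dots> = 2 ^ r * B"
    by (rule sum_binomial_mult)
  finally show ?thesis .
qed

lemma continuous_on_fwd_diff:
  assumes "continuous_on UNIV f"
  shows "continuous_on S (fwd_diff r h f)"
  unfolding fwd_diff_def
  by (intro continuous_intros continuous_on_compose2[OF assms]) auto

text \<open>
  The function \<open>\<lambda>y. D 0 (y + h) - D 0 y\<close> has the derivatives \<open>\<lambda>y. D i (y + h) - D i y\<close>, and the one
  of order \<open>r - 1\<close> is nonnegative by monotonicity. Induction through \<open>fwd_diff_Suc\<close> thus replaces the
  usual integral representation of the difference.
\<close>
lemma fwd_diff_nonneg:
  assumes "\<And>i x. i < r \<Longrightarrow> (D i has_real_derivative D (Suc i) x) (at x)"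
    and "0 \<le> h" and "\<And>y. x \<le> y \<Longrightarrow> y \<le> x + real r * h \<Longrightarrow> 0 \<le> D r y"
  shows "0 \<le> fwd_diff r h (D 0) x"
  using assms
proof (induction r arbitrary: D)
  case (Suc r)
  have "0 \<le> fwd_diff r h (\<lambda>y. D 0 (y + h) - D 0 y) x"
  proof (rule Suc.IH[where D = "\<lambda>i y. D i (y + h) - D i y"])
    fix i y assume "i < r"
    then show "((\<lambda>y. D i (y + h) - D i y) has_real_derivative D (Suc i) (y + h) - D (Suc i) y) (at y)"
      by (intro derivative_intros DERIV_shift[THEN iffD1] Suc.prems) auto
  next
    fix y assume y: "x \<le> y" "y \<le> x + real r * h"
    have "D r y \<le> D r (y + h)"
    proof (rule DERIV_nonneg_imp_nondecreasing[where f = "D r"])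
      fix z assume z: "y \<le> z" "z \<le> y + h"
      then have "0 \<le> D (Suc r) z" using y Suc.prems(3)[of z] by (auto simp: algebra_simps)
      then show "\<exists>d. (D r has_real_derivative d) (at z) \<and> 0 \<le> d"
        using Suc.prems(1)[of r z] by blast
    qed (use Suc.prems in auto)
    then show "0 \<le> D r (y + h) - D r y" by simp
  qed (use Suc.prems in auto)
  then show ?case by (simp add: fwd_diff_Suc)
qed simp

text \<open>
  Each difference step multiplies by \<open>2 * sin (\<mu> * h / 2)\<close> and shifts the phase. The phase \<open>c\<close> is
  kept arbitrary because it changes in the induction.
\<close>
lemma fwd_diff_sin:
  "fwd_diff r h (\<lambda>x. sin (\<mu> * x + c)) x
     = (2 * sin (\<mu> * h / 2)) ^ r * sin (\<mu> * x + (c + real r * (\<mu> * h / 2 + pi / 2)))"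
proof (induction r arbitrary: c)
  case (Suc r)
  have step: "sin (\<mu> * (y + h) + c) - sin (\<mu> * y + c)
      = 2 * sin (\<mu> * h / 2) * sin (\<mu> * y + (c + (\<mu> * h / 2 + pi / 2)))" for y
    proof -
    have arg: "\<mu> * (y + h) + c = (\<mu> * y + c + \<mu> * h / 2) + \<mu> * h / 2"
      "\<mu> * y + c = (\<mu> * y + c + \<mu> * h / 2) - \<mu> * h / 2"
      "\<mu> * y + (c + (\<mu> * h / 2 + pi / 2)) = (\<mu> * y + c + \<mu> * h / 2) + pi / 2"
      by (simp_all add: algebra_simps)
    have "sin (A + B) - sin (A - B) = 2 * sin B * sin (A + pi / 2)" for A B :: real
      by (simp add: sin_add sin_diff)
    from this[of "\<mu> * y + c + \<mu> * h / 2" "\<mu> * h / 2"] show ?thesis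
      by (simp only: arg[symmetric])
  qed
  show ?case
    by (simp add: fwd_diff_Suc step fwd_diff_scale Suc.IH) (simp add: algebra_simps add_divide_distrib)
qed simp

lemma abs_fwd_diff_sin_le:
  assumes "0 \<le> \<mu>" "0 \<le> h"
  shows "\<bar>fwd_diff r h (\<lambda>x. sin (\<mu> * x)) x\<bar> \<le> (\<mu> * h) ^ r"
proof -
  have "\<bar>2 * sin (\<mu> * h / 2)\<bar> ^ r \<le> (\<mu> * h) ^ r"
    using abs_sin_x_le_abs_x[of "\<mu> * h / 2"] assms by (intro power_mono) auto
  moreover have "\<bar>fwd_diff r h (\<lambda>x. sin (\<mu> * x)) x\<bar> \<le> \<bar>2 * sin (\<mu> * h / 2)\<bar> ^ r * 1"
    using mult_left_mono[OF abs_sin_le_one, of "\<bar>2 * sin (\<mu> * h / 2)\<bar> ^ r"]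
      fwd_diff_sin[of r h \<mu> 0 x] by (simp add: abs_mult power_abs)
  ultimately show ?thesis by simp
qed

section \<open>Derivatives and differences of arcus tangens networks\<close>

text \<open>
  Differentiating \<open>q / (1 + x\<^sup>2) ^ i\<close> gives the numerator \<open>q' (1 + x\<^sup>2) - 2 i x q\<close> over the next
  power, so each derivative raises the degree by at most one. The equation for \<open>i = 0\<close> is excluded, as the
  arcus tangens itself is not rational.
\<close>
lemma arctan_iterated_derivative:
  obtains T :: "nat \<Rightarrow> real \<Rightarrow> real" and q :: "nat \<Rightarrow> real poly"
  where "T 0 = arctan"
    and "\<And>i x. (T i has_real_derivative T (Suc i) x) (at x)"
    and "\<And>i x. 1 \<le> i \<Longrightarrow> T i x * (1 + x\<^sup>2) ^ i = poly (q i) x"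
    and "\<And>i. degree (q i) \<le> i"
proof -
  define q :: "nat \<Rightarrow> real poly" where
    "q = rec_nat 0 (\<lambda>i p. if i = 0 then 1 else pderiv p * [:1, 0, 1:] - [:0, 2 * real i:] * p)"
  have q1: "q (Suc 0) = 1" by (simp add: q_def)
  have qS: "q (Suc i) = pderiv (q i) * [:1, 0, 1:] - [:0, 2 * real i:] * q i" if "i > 0" for i
    using that by (simp add: q_def)
  have deg: "degree (q i) \<le> i - 1" for i
  proof (induction i)
    case (Suc i)
    show ?case
    proof (cases "i = 0")
      case False
      have "degree (pderiv (q i) * [:1, 0, 1:]) \<le> i"
      proof (cases "degree (q i) = 0")
        case True
        then have "pderiv (q i) = 0" by (simp add: pderiv_eq_0_iff)
        then show ?thesis by simp
      next
        case nz: False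
        have "degree (pderiv (q i) * [:1, 0, 1:]) \<le> degree (q i) - 1 + 2"
          by (rule order_trans[OF degree_mult_le]) (simp add: degree_pderiv)
        then show ?thesis using nz Suc by linarith
      qed
      moreover have "degree ([:0, 2 * real i:] * q i) \<le> i"
        by (rule order_trans[OF degree_mult_le]) (use Suc False in auto)
      ultimately show ?thesis using False by (auto simp: qS intro: degree_diff_le)
    qed (simp add: q1)
  qed (simp add: q_def)
  define T where "T i = (if i = 0 then arctan else (\<lambda>x. poly (q i) x / (1 + x\<^sup>2) ^ i))" for i
  have der: "(T i has_real_derivative T (Suc i) x) (at x)" for i x
  proof (cases i)
    case 0
    then show ?thesis by (auto simp: T_def q1 intro!: derivative_eq_intros) (simp add: field_simps)
  next
    case (Suc j)
    have pos: "1 + x\<^sup>2 > 0" by (simp add: add_pos_nonneg)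
    have "((\<lambda>x. (1 + x\<^sup>2) ^ i) has_real_derivative real i * (1 + x\<^sup>2) ^ j * (2 * x)) (at x)"
    proof -
      have "((\<lambda>x. 1 + x\<^sup>2) has_real_derivative 2 * x) (at x)"
        by (auto intro!: derivative_eq_intros)
      from DERIV_power[OF this, of i] show ?thesis by (simp add: Suc mult_ac)
    qed
    then have "((\<lambda>x. poly (q i) x / (1 + x\<^sup>2) ^ i) has_real_derivative
        (poly (pderiv (q i)) x * (1 + x\<^sup>2) ^ i
          - poly (q i) x * (real i * (1 + x\<^sup>2) ^ j * (2 * x))) / ((1 + x\<^sup>2) ^ i * (1 + x\<^sup>2) ^ i)) (at x)"
      by (intro DERIV_divide poly_DERIV) (use pos in auto)
    also have "(poly (pderiv (q i)) x * (1 + x\<^sup>2) ^ i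
          - poly (q i) x * (real i * (1 + x\<^sup>2) ^ j * (2 * x))) / ((1 + x\<^sup>2) ^ i * (1 + x\<^sup>2) ^ i)
        = ((1 + x\<^sup>2) ^ j * poly (q (Suc i)) x) / ((1 + x\<^sup>2) ^ j * (1 + x\<^sup>2) ^ Suc i)"
      using Suc by (simp add: qS algebra_simps power2_eq_square)
    also have "\<dots> = poly (q (Suc i)) x / (1 + x\<^sup>2) ^ Suc i"
      using pos by simp
    finally show ?thesis using Suc by (simp add: T_def)
  qed
  have "T i x * (1 + x\<^sup>2) ^ i = poly (q i) x" if "1 \<le> i" for i x
  proof -
    have "1 + x\<^sup>2 > 0" by (simp add: add_pos_nonneg)
    then show ?thesis using that by (simp add: T_def)
  qed
  moreover have "degree (q i) \<le> i" for i using deg[of i] by linarith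
  ultimately show thesis using der by (intro that[of T q]) (auto simp: T_def)
qed

text \<open>
  Over the common denominator \<open>\<Prod>k. (1 + (b k * x + c k)\<^sup>2) ^ r\<close> each summand has a numerator of degree at
  most \<open>r + 2 * r * (n - 1)\<close>. This bound is linear in \<open>n\<close>, so a
  network with \<open>n\<close> units cannot follow an oscillation with many more than \<open>n\<close> periods.
\<close>
lemma network_iterated_derivative:
  fixes a b c :: "nat \<Rightarrow> real" and n :: nat
  assumes "1 \<le> r"
  obtains D :: "nat \<Rightarrow> real \<Rightarrow> real" and P Q :: "real poly"
  where "D 0 = (\<lambda>x. \<Sum>k=1..n. a k * sigma_a (b k * x + c k))"
    and "\<And>i x. (D i has_real_derivative D (Suc i) x) (at x)"
    and "\<And>x. D r x * poly Q x = poly P x" and "\<And>x. poly Q x > 0"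
    and "degree P \<le> 2 * r * n"
proof -
  obtain T :: "nat \<Rightarrow> real \<Rightarrow> real" and q :: "nat \<Rightarrow> real poly"
    where T0: "T 0 = arctan" and T: "\<And>i x. (T i has_real_derivative T (Suc i) x) (at x)"
      and Tq: "\<And>i x. 1 \<le> i \<Longrightarrow> T i x * (1 + x\<^sup>2) ^ i = poly (q i) x"
      and degq: "\<And>i. degree (q i) \<le> i"
    by (rule arctan_iterated_derivative; rule that)
  define D where "D i x = (\<Sum>k=1..n. (if i = 0 then a k / 2 else 0)
      + a k / pi * b k ^ i * T i (b k * x + c k))" for i x
  define w where "w k = [:1:] + [:c k, b k:] ^ 2" for k
  define Q where "Q = (\<Prod>k=1..n. w k ^ r)"
  define P where "P = (\<Sum>k=1..n. smult (a k / pi * b k ^ r) (pcompose (q r) [:c k, b k:])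
      * (\<Prod>j\<in>{1..n} - {k}. w j ^ r))"
  have w: "poly (w k) x = 1 + (b k * x + c k)\<^sup>2" for k x
    by (simp add: w_def algebra_simps)
  have wpos: "poly (w k) x > 0" for k x
    unfolding w by (simp add: add_pos_nonneg)
  have degw: "degree (w k ^ r) \<le> 2 * r" for k
  proof -
    have "degree ([:c k, b k:] ^ 2) \<le> 1 * 2"
      by (rule order_trans[OF degree_power_le]) (simp add: degree_pCons_le)
    then have "degree (w k) \<le> 2" unfolding w_def by (intro degree_add_le) auto
    then show ?thesis by (intro order_trans[OF degree_power_le] mult_le_mono1)
  qed
  show thesis
  proof (rule that[of D Q P])
    show "D 0 = (\<lambda>x. \<Sum>k=1..n. a k * sigma_a (b k * x + c k))"
      by (auto simp: D_def T0 sigma_a_def fun_eq_iff algebra_simps intro!: sum.cong)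
    show "(D i has_real_derivative D (Suc i) x) (at x)" for i x
    proof -
      have "((\<lambda>x. T i (b k * x + c k)) has_real_derivative T (Suc i) (b k * x + c k) * b k) (at x)" for k
        by (rule DERIV_chain2[OF T]) (auto intro!: derivative_eq_intros)
      then have "((\<lambda>x. (if i = 0 then a k / 2 else 0) + a k / pi * b k ^ i * T i (b k * x + c k))
          has_real_derivative 0 + a k / pi * b k ^ i * (T (Suc i) (b k * x + c k) * b k)) (at x)" for k
        by (intro DERIV_add DERIV_const DERIV_cmult)
      then have "(D i has_real_derivative
          (\<Sum>k=1..n. 0 + a k / pi * b k ^ i * (T (Suc i) (b k * x + c k) * b k))) (at x)"
        unfolding D_def by (intro DERIV_sum)
      then show ?thesis by (simp add: D_def mult_ac)
    qed
    show "D r x * poly Q x = poly P x" for x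
      unfolding D_def P_def poly_sum sum_distrib_right
    proof (rule sum.cong)
      fix k assume k: "k \<in> {1..n}"
      have "poly Q x = poly (w k) x ^ r * (\<Prod>j\<in>{1..n} - {k}. poly (w j) x ^ r)"
        unfolding Q_def poly_prod using k by (subst prod.remove[of _ k]) auto
      moreover have "T r (b k * x + c k) * poly (w k) x ^ r = poly (q r) (b k * x + c k)"
        using Tq[OF assms] by (simp add: w)
      ultimately show "((if r = 0 then a k / 2 else 0) + a k / pi * b k ^ r * T r (b k * x + c k)) * poly Q x
         = poly (smult (a k / pi * b k ^ r) (pcompose (q r) [:c k, b k:]) * (\<Prod>j\<in>{1..n} - {k}. w j ^ r)) x"
        using assms by (simp add: poly_pcompose poly_prod algebra_simps)
    qed simp
    show "poly Q x > 0" for x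
      unfolding Q_def poly_prod using wpos by (auto intro!: prod_pos)
    show "degree P \<le> 2 * r * n"
      unfolding P_def
    proof (rule degree_sum_le)
      fix k assume k: "k \<in> {1..n}"
      have "degree (pcompose (q r) [:c k, b k:]) \<le> r * 1"
        by (rule order_trans[OF degree_pcompose_le]) (intro mult_le_mono degq degree_pCons_le[THEN order_trans], simp)
      then have 1: "degree (smult (a k / pi * b k ^ r) (pcompose (q r) [:c k, b k:])) \<le> r"
        by (intro order_trans[OF degree_smult_le]) simp
      have "degree (\<Prod>j\<in>{1..n} - {k}. w j ^ r) \<le> (\<Sum>j\<in>{1..n} - {k}. degree (w j ^ r))"
        using degree_prod_sum_le[of "{1..n} - {k}" "\<lambda>j. w j ^ r"] by (simp add: o_def)
      also have "\<dots> \<le> (\<Sum>j\<in>{1..n} - {k}. 2 * r)" by (rule sum_mono) (rule degw)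
      also have "\<dots> = 2 * r * (n - 1)" using k by simp
      finally have 2: "degree (\<Prod>j\<in>{1..n} - {k}. w j ^ r) \<le> 2 * r * (n - 1)" .
      have "degree (smult (a k / pi * b k ^ r) (pcompose (q r) [:c k, b k:])
            * (\<Prod>j\<in>{1..n} - {k}. w j ^ r)) \<le> r + 2 * r * (n - 1)"
        by (rule order_trans[OF degree_mult_le]) (use 1 2 in linarith)
      also have "r + 2 * r * (n - 1) \<le> 2 * r * n"
        using k by (cases n) auto
      finally show "degree (smult (a k / pi * b k ^ r) (pcompose (q r) [:c k, b k:])
            * (\<Prod>j\<in>{1..n} - {k}. w j ^ r)) \<le> 2 * r * n" .
    qed simp
  qed
qed

text \<open>
  A subinterval is bad if the numerator of the \<open>r\<close>-th derivative vanishes somewhere on it. The subintervals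
  are disjoint, being half-open, so there are at most as many bad ones as zeros. On the others the
  derivative keeps its sign by the intermediate value theorem, and \<open>fwd_diff_nonneg\<close> applies. If the
  numerator is the zero polynomial, all differences vanish and no subinterval is bad.
\<close>
lemma network_fwd_diff_sign:
  fixes a b c :: "nat \<Rightarrow> real" and n :: nat
  assumes "1 \<le> r" and "1 \<le> L"
  obtains B where "B \<subseteq> {..<L}" and "card B \<le> 2 * r * n"
    and "\<And>i. i < L \<Longrightarrow> i \<notin> B \<Longrightarrow> \<exists>s\<in>{1, -1}. \<forall>x h. 0 \<le> h \<longrightarrow> real i / real L \<le> x \<longrightarrow>
           x + real r * h < real (Suc i) / real L \<longrightarrow>
           0 \<le> s * fwd_diff r h (\<lambda>x. \<Sum>k=1..n. a k * sigma_a (b k * x + c k)) x"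
proof -
  obtain D :: "nat \<Rightarrow> real \<Rightarrow> real" and P Q :: "real poly"
    where D0: "D 0 = (\<lambda>x. \<Sum>k=1..n. a k * sigma_a (b k * x + c k))"
      and D: "\<And>i x. (D i has_real_derivative D (Suc i) x) (at x)"
      and PQ: "\<And>x. D r x * poly Q x = poly P x" and Q: "\<And>x. poly Q x > 0"
      and deg: "degree P \<le> 2 * r * n"
    by (rule network_iterated_derivative[OF assms(1), where n = n and a = a and b = b and c = c]; rule that)
  have zero: "D r x = 0 \<longleftrightarrow> poly P x = 0" for x
    using PQ[of x] Q[of x] by (metis mult_eq_0_iff less_irrefl)
  have sign: "0 \<le> s * fwd_diff r h (D 0) x"
    if "0 \<le> h" "\<And>y. x \<le> y \<Longrightarrow> y \<le> x + real r * h \<Longrightarrow> 0 \<le> s * D r y" for s x h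
  proof -
    have "0 \<le> fwd_diff r h ((\<lambda>i y. s * D i y) 0) x"
      by (rule fwd_diff_nonneg) (use D that in \<open>auto intro!: derivative_eq_intros\<close>)
    then show ?thesis by (simp add: fwd_diff_scale)
  qed
  show thesis
  proof (cases "P = 0")
    case True
    then have "D r y = 0" for y using zero by simp
    then have "0 \<le> 1 * fwd_diff r h (D 0) x" if "0 \<le> h" for h x
      by (intro sign that) simp
    then show thesis by (intro that[of "{}"]) (auto simp: D0)
  next
    case False
    define B where "B = {i. i < L \<and> (\<exists>x. poly P x = 0 \<and> real i / real L \<le> x \<and> x < real (Suc i) / real L)}"
    have fin: "finite {x. poly P x = 0}" using False by (rule poly_roots_finite)
    have "B \<subseteq> (\<lambda>x. nat \<lfloor>real L * x\<rfloor>) ` {x. poly P x = 0}"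
    proof
      fix i assume "i \<in> B"
      then obtain x where x: "poly P x = 0" "real i / real L \<le> x" "x < real (Suc i) / real L"
        unfolding B_def by blast
      then have "real i \<le> real L * x" "real L * x < real i + 1"
        using assms(2) by (auto simp: field_simps)
      then have "\<lfloor>real L * x\<rfloor> = int i" by linarith
      then show "i \<in> (\<lambda>x. nat \<lfloor>real L * x\<rfloor>) ` {x. poly P x = 0}"
        using x by (intro image_eqI[of _ _ x]) auto
    qed
    then have "card B \<le> card {x. poly P x = 0}"
      using fin by (meson card_image_le card_mono finite_imageI order_trans)
    also have "\<dots> \<le> 2 * r * n" using card_poly_roots_bound[OF False] deg by linarith
    finally have card: "card B \<le> 2 * r * n" .
    show thesis
    proof (rule that[OF _ card])
      show "B \<subseteq> {..<L}" by (auto simp: B_def)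
      fix i assume i: "i < L" "i \<notin> B"
      define z where "z = real i / real L"
      define s where "s = sgn (D r z)"
      have nz: "D r x \<noteq> 0" if "z \<le> x" "x < real (Suc i) / real L" for x
        using i that unfolding B_def zero z_def by blast
      have "z < real (Suc i) / real L" using assms(2) by (simp add: z_def divide_strict_right_mono)
      then have z0: "D r z \<noteq> 0" using nz by simp
      have s: "s \<in> {1, -1}" using z0 by (auto simp: s_def sgn_if)
      have pos: "0 \<le> s * D r y" if y: "z \<le> y" "y < real (Suc i) / real L" for y
      proof (rule ccontr)
        assume neg: "\<not> 0 \<le> s * D r y"
        have "continuous_on {z..y} (\<lambda>t. s * D r t)"
          by (intro continuous_on_mult_left)
            (meson D DERIV_isCont continuous_at_imp_continuous_on)
        moreover have "0 \<le> s * D r z" by (simp add: s_def sgn_if)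
        ultimately obtain t where "z \<le> t" "t \<le> y" "s * D r t = 0"
          using IVT2'[of "\<lambda>t. s * D r t" y 0 z] neg y by auto
        then show False using nz[of t] s y by auto
      qed
      have "0 \<le> s * fwd_diff r h (D 0) x"
        if "0 \<le> h" "z \<le> x" "x + real r * h < real (Suc i) / real L" for x h
        using that by (intro sign pos) auto
      with s show "\<exists>s\<in>{1, -1}. \<forall>x h. 0 \<le> h \<longrightarrow> real i / real L \<le> x \<longrightarrow>
           x + real r * h < real (Suc i) / real L \<longrightarrow>
           0 \<le> s * fwd_diff r h (\<lambda>x. \<Sum>k=1..n. a k * sigma_a (b k * x + c k)) x"
        unfolding z_def D0 by blast
    qed
  qed
qed

text \<open>
  Multiplying \<open>-s * sin\<close> by the weight \<open>(1 - s * sin) / 2\<close>, which lies in \<open>[0,1]\<close> for a sign \<open>s\<close>, gives this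
  integrand. Its mean over a period is \<open>1/4\<close> since the linear part averages out.
\<close>
lemma has_integral_weighted_sine_period:
  fixes \<mu> :: real
  assumes "0 < \<mu>"
  shows "((\<lambda>x. ((sin (\<mu> * x + \<theta>))\<^sup>2 - s * sin (\<mu> * x + \<theta>)) / 2)
    has_integral (2 * pi / \<mu>) / 4) {c..c + 2 * pi / \<mu>}"
proof -
  define F where "F x = x / 4 - sin (\<mu> * x + \<theta>) * cos (\<mu> * x + \<theta>) / (4 * \<mu>)
      + s * cos (\<mu> * x + \<theta>) / (2 * \<mu>)" for x
  have "((\<lambda>x. ((sin (\<mu> * x + \<theta>))\<^sup>2 - s * sin (\<mu> * x + \<theta>)) / 2)
    has_integral F (c + 2 * pi / \<mu>) - F c) {c..c + 2 * pi / \<mu>}"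
  proof (rule fundamental_theorem_of_calculus)
    fix x
    have "(F has_real_derivative 1 / 4 - (cos (\<mu> * x + \<theta>) * cos (\<mu> * x + \<theta>)
        - sin (\<mu> * x + \<theta>) * sin (\<mu> * x + \<theta>)) / 4 - s * sin (\<mu> * x + \<theta>) / 2) (at x)"
      unfolding F_def using assms
      by (auto intro!: derivative_eq_intros simp: field_simps)
    also have "1 / 4 - (cos (\<mu> * x + \<theta>) * cos (\<mu> * x + \<theta>)
        - sin (\<mu> * x + \<theta>) * sin (\<mu> * x + \<theta>)) / 4 - s * sin (\<mu> * x + \<theta>) / 2
      = ((sin (\<mu> * x + \<theta>))\<^sup>2 - s * sin (\<mu> * x + \<theta>)) / 2"
    proof -
      have "cos (\<mu> * x + \<theta>) * cos (\<mu> * x + \<theta>) = 1 - sin (\<mu> * x + \<theta>) * sin (\<mu> * x + \<theta>)"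
        using sin_cos_squared_add[of "\<mu> * x + \<theta>"] unfolding power2_eq_square by linarith
      then show ?thesis by (simp only: power2_eq_square) (simp add: field_simps)
    qed
    finally show "(F has_vector_derivative ((sin (\<mu> * x + \<theta>))\<^sup>2 - s * sin (\<mu> * x + \<theta>)) / 2)
        (at x within {c..c + 2 * pi / \<mu>})"
      by (simp add: has_real_derivative_iff_has_vector_derivative has_vector_derivative_at_within)
  qed (use assms in simp)
  moreover have "F (c + 2 * pi / \<mu>) - F c = (2 * pi / \<mu>) / 4"
  proof -
    have "\<mu> * (c + 2 * pi / \<mu>) + \<theta> = (\<mu> * c + \<theta>) + 2 * pi"
      using assms by (simp add: field_simps)
    then have "sin (\<mu> * (c + 2 * pi / \<mu>) + \<theta>) = sin (\<mu> * c + \<theta>)"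
      "cos (\<mu> * (c + 2 * pi / \<mu>) + \<theta>) = cos (\<mu> * c + \<theta>)"
      by (simp_all only: sin_periodic cos_periodic)
    then show ?thesis unfolding F_def by (simp only:) (simp add: add_divide_distrib)
  qed
  ultimately show ?thesis by simp
qed

text \<open>
  The translates \<open>u (x + j h)\<close> with \<open>x\<close> in \<open>[a,b]\<close> all live on \<open>[a, b + r h]\<close>; the binomial
  coefficients sum to \<open>2 ^ r\<close>.
\<close>
lemma integral_abs_fwd_diff_le:
  assumes u: "continuous_on UNIV u" and "0 \<le> h" and "a \<le> b"
  shows "integral {a..b} (\<lambda>x. \<bar>fwd_diff r h u x\<bar>)
    \<le> 2 ^ r * integral {a..b + real r * h} (\<lambda>x. \<bar>u x\<bar>)"
proof -
  have int: "(\<lambda>x. \<bar>u x\<bar>) integrable_on {c..d}" for c d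
    by (intro integrable_continuous_real continuous_intros continuous_on_subset[OF u]) auto
  have shift: "continuous_on {a..b} (\<lambda>x. \<bar>u (x + d)\<bar>)" for d
    by (intro continuous_intros continuous_on_compose2[OF u]) auto
  have "integral {a..b} (\<lambda>x. \<bar>fwd_diff r h u x\<bar>)
      \<le> integral {a..b} (\<lambda>x. \<Sum>j=0..r. real (r choose j) * \<bar>u (x + real j * h)\<bar>)"
    by (intro integral_le integrable_continuous_real continuous_intros continuous_on_fwd_diff[OF u]
        shift abs_fwd_diff_le)
  also have "\<dots> = (\<Sum>j=0..r. real (r choose j) * integral {a..b} (\<lambda>x. \<bar>u (x + real j * h)\<bar>))"
    by (subst integral_sum) (auto intro!: integrable_continuous_real continuous_intros shift)
  also have "\<dots> \<le> (\<Sum>j=0..r. real (r choose j) * integral {a..b + real r * h} (\<lambda>x. \<bar>u x\<bar>))"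
  proof (intro sum_mono mult_left_mono)
    fix j assume "j \<in> {0..r}"
    then have j: "real j * h \<le> real r * h" "0 \<le> real j * h"
      using assms by (auto intro: mult_right_mono)
    have "integral {a..b} (\<lambda>x. \<bar>u (x + real j * h)\<bar>)
        = integral {a + real j * h..b + real j * h} (\<lambda>x. \<bar>u x\<bar>)"
      using integral_shift_real_ivl[of "a + real j * h" "real j * h" "b + real j * h" "\<lambda>x. \<bar>u x\<bar>"]
      by simp
    also have "\<dots> \<le> integral {a..b + real r * h} (\<lambda>x. \<bar>u x\<bar>)"
      by (rule integral_subset_le) (use j int in auto)
    finally show "integral {a..b} (\<lambda>x. \<bar>u (x + real j * h)\<bar>)
        \<le> integral {a..b + real r * h} (\<lambda>x. \<bar>u x\<bar>)" .
  qed simp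
  also have "\<dots> = 2 ^ r * integral {a..b + real r * h} (\<lambda>x. \<bar>u x\<bar>)"
    by (rule sum_binomial_mult)
  finally show ?thesis .
qed

lemma sum_integral_subdivision_le:
  fixes v :: "real \<Rightarrow> real"
  assumes v: "continuous_on UNIV v" "\<And>x. 0 \<le> v x" and "1 \<le> L" and "S \<subseteq> {..<L}"
  shows "(\<Sum>i\<in>S. integral {real i / real L..real (Suc i) / real L} v) \<le> integral {0..1} v"
proof -
  have int: "v integrable_on {c..d}" for c d
    by (intro integrable_continuous_real continuous_on_subset[OF v(1)]) auto
  have "(\<Sum>i<m. integral {real i / real L..real (Suc i) / real L} v)
      = integral {0..real m / real L} v" for m
  proof (induction m)
    case (Suc m)
    have "integral {0..real m / real L} v + integral {real m / real L..real (Suc m) / real L} v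
        = integral {0..real (Suc m) / real L} v"
      by (intro Henstock_Kurzweil_Integration.integral_combine int divide_right_mono) auto
    with Suc show ?case by (simp only: sum.lessThan_Suc)
  qed simp
  from this[of L] have "(\<Sum>i<L. integral {real i / real L..real (Suc i) / real L} v) = integral {0..1} v"
    using assms by simp
  moreover have "(\<Sum>i\<in>S. integral {real i / real L..real (Suc i) / real L} v)
      \<le> (\<Sum>i<L. integral {real i / real L..real (Suc i) / real L} v)"
    using assms by (intro sum_mono2 integral_nonneg int) auto
  ultimately show ?thesis by simp
qed

text \<open>
  The core of the lower bound. The perturbation \<open>R\<close> stands for the other summands of the lacunary series. The
  step \<open>h\<close> is chosen so that \<open>r h\<close> is a quarter of a subinterval: then the translates occurring in a
  difference that starts in the left half of a subinterval stay inside it, and that left half is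
  exactly one period of the sine. Testing the difference against the weight \<open>w\<close> below
  discards the network, whose contribution has a favourable sign, and retains a quarter of the
  amplitude of the sine.
\<close>
lemma network_error_lower_bound:
  fixes a b c :: "nat \<Rightarrow> real" and n :: nat
  defines "G \<equiv> \<lambda>x. \<Sum>k=1..n. a k * sigma_a (b k * x + c k)"
  assumes "1 \<le> r" "1 \<le> n" and L: "L = 4 * r * n" and h: "h = 1 / (4 * real r * real L)"
    and A: "A = (2 * sin (pi / (2 * real r))) ^ r"
    and R: "continuous_on UNIV R" "\<And>x. \<bar>fwd_diff r h R x\<bar> \<le> A * t / 8" and "0 \<le> t"
  shows "A * t / 32 \<le> 2 ^ r * integral {0..1} (\<lambda>x. \<bar>t * sin (4 * pi * real L * x) + R x - G x\<bar>)"
proof -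
  define u where "u x = t * sin (4 * pi * real L * x) + R x - G x" for x
  define \<mu> where "\<mu> = 4 * pi * real L"
  define \<theta> where "\<theta> = real r * (pi / (2 * real r) + pi / 2)"
  have L1: "1 \<le> L" using assms by (simp add: L)
  have \<mu>: "0 < \<mu>" "2 * pi / \<mu> = 1 / (2 * real L)" using L1 by (auto simp: \<mu>_def)
  have rh: "real r * h = 1 / (4 * real L)" "0 \<le> h" using assms L1 by (auto simp: h)
  have A0: "0 \<le> A"
    unfolding A using assms by (intro zero_le_power mult_nonneg_nonneg sin_ge_zero) (auto simp: field_simps)
  have Gcont: "continuous_on UNIV G"
    unfolding G_def sigma_a_def by (intro continuous_intros)
  have ucont: "continuous_on UNIV u"
    unfolding u_def by (intro continuous_intros R Gcont)
  have \<Delta>u: "fwd_diff r h u x = t * A * sin (\<mu> * x + \<theta>) + fwd_diff r h R x - fwd_diff r h G x" for x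
  proof -
    have "\<mu> * h / 2 = pi / (2 * real r)" using L1 by (simp add: \<mu>_def h)
    then have "fwd_diff r h (\<lambda>x. sin (\<mu> * x)) x = A * sin (\<mu> * x + \<theta>)"
      using fwd_diff_sin[of r h \<mu> 0 x] by (simp only: A \<theta>_def add_0_left add_0_right)
    moreover have "u = (\<lambda>x. (t * sin (\<mu> * x) - (0 - R x)) - G x)"
      by (auto simp: u_def \<mu>_def)
    ultimately show ?thesis
      by (simp only: fwd_diff_diff fwd_diff_scale) (simp add: fwd_diff_def)
  qed
  obtain B where B: "B \<subseteq> {..<L}" "card B \<le> 2 * r * n"
    and sgn: "\<And>i. i < L \<Longrightarrow> i \<notin> B \<Longrightarrow> \<exists>s\<in>{1, -1}. \<forall>x h. 0 \<le> h \<longrightarrow> real i / real L \<le> x \<longrightarrow>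
           x + real r * h < real (Suc i) / real L \<longrightarrow> 0 \<le> s * fwd_diff r h G x"
    using network_fwd_diff_sign[OF assms(2) L1, of n a b c] unfolding G_def by blast
  have piece: "A * t / (16 * real L) \<le> 2 ^ r * integral {real i / real L..real (Suc i) / real L} (\<lambda>x. \<bar>u x\<bar>)"
    if i: "i < L" "i \<notin> B" for i
  proof -
    define z where "z = real i / real L"
    define T where "T = 1 / (2 * real L)"
    define \<phi> where "\<phi> x = sin (\<mu> * x + \<theta>)" for x
    obtain s where s: "s \<in> {1, -1}" and G: "\<And>x h. 0 \<le> h \<Longrightarrow> z \<le> x \<Longrightarrow>
           x + real r * h < real (Suc i) / real L \<Longrightarrow> 0 \<le> s * fwd_diff r h G x"
      using sgn[OF i] unfolding z_def by blast
    have end_lt: "z + T + real r * h < real (Suc i) / real L"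
      using L1 unfolding z_def T_def rh by (simp add: field_simps)
    have low: "t * A * (((\<phi> x)\<^sup>2 - s * \<phi> x) / 2) - A * t / 8 \<le> \<bar>fwd_diff r h u x\<bar>"
      if x: "x \<in> {z..z + T}" for x
    proof -
      define w where "w = (1 - s * \<phi> x) / 2"
      define X where "X = fwd_diff r h u x"
      have \<phi>1: "\<bar>s * \<phi> x\<bar> \<le> 1" using s by (auto simp: \<phi>_def)
      then have w: "0 \<le> w" "w \<le> 1" by (auto simp: w_def abs_le_iff)
      have g0: "0 \<le> s * fwd_diff r h G x"
        using x end_lt rh by (intro G) auto
      have ss: "s * s = 1" using s by auto
      have "- s * X = - (t * A * (s * \<phi> x)) - s * fwd_diff r h R x + s * fwd_diff r h G x"
        unfolding X_def \<Delta>u \<phi>_def by (simp add: algebra_simps)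
      moreover have "\<bar>s * fwd_diff r h R x\<bar> \<le> A * t / 8" using s R(2)[of x] by auto
      ultimately have "- (t * A * (s * \<phi> x)) - A * t / 8 \<le> - s * X"
        using g0 by linarith
      then have "w * (- (t * A * (s * \<phi> x)) - A * t / 8) \<le> w * (- s * X)"
        using w(1) by (rule mult_left_mono)
      also have "w * (- s * X) \<le> \<bar>X\<bar>"
      proof -
        have "w * (- s * X) \<le> w * \<bar>X\<bar>" using s w by (intro mult_left_mono) auto
        also have "\<dots> \<le> 1 * \<bar>X\<bar>" using w by (intro mult_right_mono) auto
        finally show ?thesis by simp
      qed
      finally have 1: "w * (- (t * A * (s * \<phi> x))) - w * (A * t / 8) \<le> \<bar>X\<bar>"
        by (simp add: algebra_simps)
      have "w * (A * t / 8) \<le> 1 * (A * t / 8)"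
        using w A0 \<open>0 \<le> t\<close> by (intro mult_right_mono) auto
      moreover have "w * (- (t * A * (s * \<phi> x))) = t * A * (((s * s) * (\<phi> x)\<^sup>2 - s * \<phi> x) / 2)"
        by (simp add: w_def power2_eq_square field_simps)
      ultimately show ?thesis using 1 by (simp add: ss X_def)
    qed
    \<comment> \<open>Integrating the lower bound over one period: the sine contributes a quarter, the perturbation at most an eighth.\<close>
    have hi: "((\<lambda>x. t * A * (((\<phi> x)\<^sup>2 - s * \<phi> x) / 2) - A * t / 8)
        has_integral t * A * (T / 4) - (z + T - z) * (A * t / 8)) {z..z + T}"
      using has_integral_weighted_sine_period[OF \<mu>(1), of \<theta> s z] has_integral_const_real[of "A * t / 8" z "z + T"]
      unfolding \<mu>(2) T_def[symmetric] \<phi>_def[symmetric]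
      by (intro has_integral_diff has_integral_mult_right) (auto simp: T_def)
    have "t * A * (T / 4) - (z + T - z) * (A * t / 8) \<le> integral {z..z + T} (\<lambda>x. \<bar>fwd_diff r h u x\<bar>)"
      by (rule has_integral_le[OF hi integrable_integral low])
        (intro integrable_continuous_real continuous_intros continuous_on_fwd_diff[OF ucont])
    also have "\<dots> \<le> 2 ^ r * integral {z..z + T + real r * h} (\<lambda>x. \<bar>u x\<bar>)"
      by (rule integral_abs_fwd_diff_le[OF ucont rh(2)]) (simp add: T_def)
    also have "\<dots> \<le> 2 ^ r * integral {z..real (Suc i) / real L} (\<lambda>x. \<bar>u x\<bar>)"
      using end_lt
      by (intro mult_left_mono integral_subset_le integrable_continuous_real continuous_intros
          continuous_on_subset[OF ucont]) auto
    finally show ?thesis unfolding z_def T_def by (simp add: field_simps)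
  qed
  define S where "S = {..<L} - B"
  have cardS: "card S = L - card B"
    unfolding S_def using B by (simp add: card_Diff_subset finite_subset)
  have "L = 2 * (2 * r * n)" by (simp add: L)
  then have "L \<le> 2 * card S" using B(2) cardS by linarith
  then have "real L / 2 \<le> real (card S)" by linarith
  then have "real L / 2 * (A * t / (16 * real L)) \<le> real (card S) * (A * t / (16 * real L))"
    using A0 \<open>0 \<le> t\<close> by (intro mult_right_mono) auto
  also have "\<dots> = (\<Sum>i\<in>S. A * t / (16 * real L))" by simp
  also have "\<dots> \<le> (\<Sum>i\<in>S. 2 ^ r * integral {real i / real L..real (Suc i) / real L} (\<lambda>x. \<bar>u x\<bar>))"
    by (intro sum_mono piece) (auto simp: S_def)
  also have "\<dots> = 2 ^ r * (\<Sum>i\<in>S. integral {real i / real L..real (Suc i) / real L} (\<lambda>x. \<bar>u x\<bar>))"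
    by (simp add: sum_distrib_left)
  also have "\<dots> \<le> 2 ^ r * integral {0..1} (\<lambda>x. \<bar>u x\<bar>)"
    by (intro mult_left_mono sum_integral_subdivision_le continuous_intros ucont L1) (auto simp: S_def)
  finally show ?thesis using L1 by (simp add: u_def)
qed

section \<open>Norms and moduli of continuous functions\<close>

lemma one_le_enn2real:
  assumes "1 \<le> p" and "p \<noteq> (\<infinity>::ennreal)"
  shows "1 \<le> enn2real p"
  using assms by (cases p rule: ennreal_cases) (auto simp flip: ennreal_1)

lemma continuous_on_abs_powr:
  fixes f :: "real \<Rightarrow> real"
  assumes "continuous_on S f" and "0 < q"
  shows "continuous_on S (\<lambda>x. \<bar>f x\<bar> powr q)"
  by (rule continuous_on_powr') (use assms in \<open>auto intro!: continuous_intros\<close>)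

lemma continuous_in_X_space:
  assumes f: "continuous_on UNIV f" and p: "1 \<le> p"
  shows "f \<in> X_space p"
proof -
  have f': "continuous_on {0..1} f" using f by (rule continuous_on_subset) simp
  show ?thesis
  proof (cases "p = \<infinity>")
    case False
    then have "0 < enn2real p" using one_le_enn2real[OF p] by simp
    then show ?thesis
      using False f' by (auto simp: X_space_def intro!: continuous_imp_measurable_on_sets_lebesgue
          continuous_imp_integrable_real continuous_on_abs_powr)
  qed (use f' in \<open>simp add: X_space_def\<close>)
qed

lemma X_norm_cong:
  assumes "\<And>x. x \<in> {0..1} \<Longrightarrow> u x = v x"
  shows "X_norm p u = X_norm p v"
proof -
  have "(SUP x\<in>{0..1}. \<bar>u x\<bar>) = (SUP x\<in>{0..1}. \<bar>v x\<bar>)"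
    by (rule SUP_cong) (simp_all add: assms)
  moreover have "(\<integral>x. \<bar>u x\<bar> powr q \<partial>lebesgue_on {0..1}) = (\<integral>x. \<bar>v x\<bar> powr q \<partial>lebesgue_on {0..1})" for q
    by (rule Bochner_Integration.integral_cong) (simp_all add: assms)
  ultimately show ?thesis by (simp add: X_norm_def)
qed

text \<open>
  Integrated with \<open>t = \<bar>u x\<bar>\<close> and \<open>m\<close> the mean of \<open>\<bar>u\<bar>\<close>, this convexity inequality is Jensen's inequality for
  the \<open>q\<close>-th power. The tangent line at \<open>m\<close> lies below the power on the open half-line;
  at \<open>t = 0\<close> its value \<open>(1 - q) * m powr q\<close> is not positive.
\<close>
lemma powr_above_tangent:
  fixes q t m :: real
  assumes "1 \<le> q" "0 < m" "0 \<le> t"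
  shows "m powr q + q * m powr (q - 1) * (t - m) \<le> t powr q"
proof (cases "t = 0")
  case True
  have "m powr (q - 1) * m = m powr q" using assms by (simp add: powr_diff)
  then have "m powr q + q * m powr (q - 1) * (t - m) = (1 - q) * m powr q"
    using True by (simp add: algebra_simps)
  also have "\<dots> \<le> 0" using assms by (intro mult_nonpos_nonneg) auto
  finally show ?thesis using True by simp
next
  case False
  have "(q * m powr (q - 1)) * (t - m) \<le> t powr q - m powr q"
  proof (rule convex_on_imp_above_tangent[OF powr_convex[OF assms(1)]])
    show "connected {0::real<..}" by simp
    have "((\<lambda>x. x powr q) has_real_derivative q * m powr (q - 1)) (at m)"
      using assms by (auto intro!: derivative_eq_intros)
    then show "((\<lambda>x. x powr q) has_real_derivative q * m powr (q - 1)) (at m within {0<..})"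
      by (rule DERIV_subset) simp
  qed (use assms False in \<open>auto simp: interior_open\<close>)
  then show ?thesis by simp
qed

lemma integral_abs_le_X_norm:
  assumes u: "continuous_on UNIV u" and p: "1 \<le> p"
  shows "integral {0..1} (\<lambda>x. \<bar>u x\<bar>) \<le> X_norm p u"
proof -
  have u': "continuous_on {0..1} u" using u by (rule continuous_on_subset) simp
  define m where "m = integral {0..1} (\<lambda>x. \<bar>u x\<bar>)"
  have int: "(\<lambda>x. \<bar>u x\<bar>) integrable_on {0..1}"
    by (intro integrable_continuous_real continuous_intros u')
  have m0: "0 \<le> m" unfolding m_def using int by (rule integral_nonneg) simp
  show ?thesis
  proof (cases "p = \<infinity>")
    case True
    have "compact ((\<lambda>x. \<bar>u x\<bar>) ` {0..1})"
      by (intro compact_continuous_image continuous_intros u') simp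
    then have bdd: "bdd_above ((\<lambda>x. \<bar>u x\<bar>) ` {0..1})"
      by (intro bounded_imp_bdd_above compact_imp_bounded)
    have "m \<le> integral {0..1} (\<lambda>x::real. SUP x\<in>{0..1}. \<bar>u x\<bar>)"
      unfolding m_def using int by (intro integral_le) (auto intro: cSUP_upper[OF _ bdd])
    then show ?thesis using True by (simp add: X_norm_def m_def)
  next
    case False
    define q where "q = enn2real p"
    have q: "1 \<le> q" unfolding q_def by (rule one_le_enn2real[OF p False])
    show ?thesis
    proof (cases "m = 0")
      case True
      then show ?thesis using False by (simp add: X_norm_def m_def)
    next
      case nz: False
      define J where "J = integral {0..1} (\<lambda>x. \<bar>u x\<bar> powr q)"
      have pint: "integrable (lebesgue_on {0..1}) (\<lambda>x. \<bar>u x\<bar> powr q)"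
        using q by (intro continuous_imp_integrable_real continuous_on_abs_powr u') simp
      have J: "J = (\<integral>x. \<bar>u x\<bar> powr q \<partial>lebesgue_on {0..1})"
        unfolding J_def by (rule lebesgue_integral_eq_integral[symmetric, OF pint]) simp
      have hi: "((\<lambda>x. m powr q + q * m powr (q - 1) * (\<bar>u x\<bar> - m)) has_integral
          (1 - 0) *\<^sub>R m powr q + q * m powr (q - 1) * (m - (1 - 0) *\<^sub>R m)) {0..1}"
        using has_integral_const_real[of "m powr q" "0::real" 1] has_integral_const_real[of m "0::real" 1]
          integrable_integral[OF int]
        by (intro has_integral_add has_integral_mult_right has_integral_diff) (auto simp: m_def)
      have "(1 - 0) *\<^sub>R m powr q + q * m powr (q - 1) * (m - (1 - 0) *\<^sub>R m) \<le> J"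
        unfolding J_def
      proof (rule has_integral_le[OF hi integrable_integral])
        show "(\<lambda>x. \<bar>u x\<bar> powr q) integrable_on {0..1}"
          using q by (intro integrable_continuous_real continuous_on_abs_powr u') simp
        show "m powr q + q * m powr (q - 1) * (\<bar>u x\<bar> - m) \<le> \<bar>u x\<bar> powr q" for x
          using q m0 nz by (intro powr_above_tangent) auto
      qed
      then have "(m powr q) powr (1 / q) \<le> J powr (1 / q)"
        using q by (intro powr_mono2) auto
      moreover have "(m powr q) powr (1 / q) = m"
        using q m0 by (simp add: powr_powr)
      ultimately show ?thesis using False by (simp add: X_norm_def m_def[symmetric] J q_def)
    qed
  qed
qed

text \<open>
  The step \<open>min \<delta> (1 / r)\<close> shows that the supremum is over a nonempty set. The domain of integration has
  measure at most one, so a uniform bound passes to all exponents.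
\<close>
lemma smoothness_modulus_bounds:
  assumes "1 \<le> r" and p: "1 \<le> p" and "0 < \<delta>"
    and bound: "\<And>h x. 0 < h \<Longrightarrow> h \<le> \<delta> \<Longrightarrow> \<bar>fwd_diff r h f x\<bar> \<le> M"
  shows "0 \<le> smoothness_modulus r f \<delta> p" and "smoothness_modulus r f \<delta> p \<le> M"
proof -
  define h0 where "h0 = min \<delta> (1 / real r)"
  have h0: "0 < h0" "h0 \<le> \<delta>" "real r * h0 \<le> 1"
    using assms by (auto simp: h0_def min_def field_simps)
  have M0: "0 \<le> M" using bound[OF h0(1,2), of 0] by linarith
  have sup: "0 \<le> Sup S \<and> Sup S \<le> M" if S: "S \<noteq> {}" "\<And>y. y \<in> S \<Longrightarrow> 0 \<le> y \<and> y \<le> M" for S :: "real set"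
  proof -
    obtain y where y: "y \<in> S" using S(1) by blast
    moreover have "bdd_above S" using S by (intro bdd_aboveI) auto
    ultimately have "y \<le> Sup S" by (rule cSup_upper)
    then show ?thesis using S y by (auto intro!: cSup_least intro: order_trans)
  qed
  have "0 \<le> smoothness_modulus r f \<delta> p \<and> smoothness_modulus r f \<delta> p \<le> M"
  proof (cases "p = \<infinity>")
    case True
    show ?thesis unfolding smoothness_modulus_def if_P[OF True]
    proof (rule sup)
      have "\<exists>x h. 0 < h \<and> h \<le> \<delta> \<and> real r * h \<le> 1 \<and> x \<in> {0..1 - real r * h}"
        using h0 by (intro exI[of _ 0] exI[of _ h0]) auto
      then show "{\<bar>fwd_diff r h f x\<bar> | x h. 0 < h \<and> h \<le> \<delta> \<and> real r * h \<le> 1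
          \<and> x \<in> {0..1 - real r * h}} \<noteq> {}"
        by blast
    qed (use bound in auto)
  next
    case False
    define q where "q = enn2real p"
    have q: "1 \<le> q" unfolding q_def by (rule one_le_enn2real[OF p False])
    have le: "(\<integral>x. \<bar>fwd_diff r h f x\<bar> powr q \<partial>lebesgue_on {0..1 - real r * h}) powr (1 / q) \<le> M"
      if h: "0 < h" "h \<le> \<delta>" "real r * h \<le> 1" for h
    proof -
      have fin: "integrable (lebesgue_on {0..1 - real r * h}) (\<lambda>x. M powr q)"
        by (intro continuous_imp_integrable_real continuous_intros)
      have "(\<integral>x. \<bar>fwd_diff r h f x\<bar> powr q \<partial>lebesgue_on {0..1 - real r * h})
          \<le> (\<integral>x. M powr q \<partial>lebesgue_on {0..1 - real r * h})"
        by (rule integral_mono'[OF fin]) (use q bound[OF h(1,2)] in \<open>auto intro!: powr_mono2\<close>)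
      also have "\<dots> = (1 - real r * h) * M powr q"
        using lebesgue_integral_eq_integral[OF fin] h by simp
      also have "\<dots> \<le> 1 * M powr q"
        using h assms by (intro mult_right_mono) auto
      finally have "(\<integral>x. \<bar>fwd_diff r h f x\<bar> powr q \<partial>lebesgue_on {0..1 - real r * h}) powr (1 / q)
          \<le> (M powr q) powr (1 / q)"
        using q by (intro powr_mono2 integral_nonneg_AE) auto
      also have "\<dots> = M" using q M0 by (simp add: powr_powr)
      finally show ?thesis .
    qed
    show ?thesis unfolding smoothness_modulus_def if_not_P[OF False] q_def[symmetric]
      by (rule sup) (use le h0 in auto)
  qed
  then show "0 \<le> smoothness_modulus r f \<delta> p" "smoothness_modulus r f \<delta> p \<le> M" by auto
qed

section \<open>Lacunary sine series\<close>

lemma abstract_modulus_pos: "abstract_modulus \<omega> \<Longrightarrow> 0 < t \<Longrightarrow> 0 < \<omega> t"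
  unfolding abstract_modulus_def by (meson zero_less_one)

text \<open>
  This says that \<open>\<omega> t / t\<close> is decreasing up to the factor two. By subadditivity
  \<open>\<omega> (m * s) \<le> m * \<omega> s\<close> for natural \<open>m\<close>, used for the first multiple of \<open>s\<close> beyond \<open>t\<close>.
\<close>
lemma abstract_modulus_ratio:
  assumes \<omega>: "abstract_modulus \<omega>" and st: "0 < s" "s \<le> t"
  shows "s * \<omega> t \<le> 2 * t * \<omega> s"
proof -
  have pos: "0 < \<omega> s" using abstract_modulus_pos[OF \<omega>] st by blast
  have mult: "\<omega> (real (Suc k) * s) \<le> real (Suc k) * \<omega> s" for k
  proof (induction k)
    case (Suc k)
    have "\<omega> (real (Suc k) * s + s) \<le> \<omega> (real (Suc k) * s) + \<omega> s"
      using \<omega> st unfolding abstract_modulus_def by simp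
    with Suc show ?case by (simp add: algebra_simps)
  qed simp
  define k where "k = nat \<lfloor>t / s\<rfloor>"
  have "1 \<le> t / s" using st by simp
  then have k: "t / s \<le> real (Suc k)" "real (Suc k) \<le> 2 * (t / s)"
    unfolding k_def by linarith+
  have "\<omega> t \<le> \<omega> (real (Suc k) * s)"
  proof (rule mono_onD[where f = \<omega> and A = "{0..}"])
    show "mono_on {0..} \<omega>" using \<omega> by (simp add: abstract_modulus_def)
    show "t \<le> real (Suc k) * s" using k st by (simp add: field_simps)
  qed (use st in auto)
  also have "\<dots> \<le> real (Suc k) * \<omega> s" by (rule mult)
  also have "\<dots> \<le> 2 * (t / s) * \<omega> s" using k pos by (intro mult_right_mono) auto
  finally show ?thesis using st by (simp add: field_simps)
qed

text \<open>
  With \<open>\<tau> = 1 / n ^ r\<close> the first condition asks \<open>\<omega> \<tau>\<close> to shrink, which holds for large \<open>n\<close> by continuity at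
  zero, and the second asks \<open>\<omega> \<tau> / \<tau>\<close> to grow, which is where the assumption that \<open>\<omega>\<close> is not of
  linear order enters.
\<close>
lemma lacunary_frequencies:
  assumes \<omega>: "abstract_modulus \<omega>" and lim: "filterlim (\<lambda>\<delta>. \<omega> \<delta> / \<delta>) at_top (at_right 0)"
    and r: "1 \<le> r" and K: "0 < K"
  obtains N :: "nat \<Rightarrow> nat" where "strict_mono N" and "\<And>k. 1 \<le> N k"
    and "\<And>k. \<omega> (1 / real (N (Suc k)) ^ r) \<le> \<omega> (1 / real (N k) ^ r) / K"
    and "\<And>k. K * (real (N k) ^ r * \<omega> (1 / real (N k) ^ r))
          \<le> real (N (Suc k)) ^ r * \<omega> (1 / real (N (Suc k)) ^ r)"
proof -
  define \<tau> where "\<tau> n = 1 / real n ^ r" for n :: nat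
  have \<tau>pos: "0 < \<tau> n" if "1 \<le> n" for n using that by (simp add: \<tau>_def)
  have \<tau>0: "\<tau> \<longlonglongrightarrow> 0"
    unfolding \<tau>_def using r
    by (intro real_tendsto_divide_at_top[OF tendsto_const] filterlim_pow_at_top filterlim_real_sequentially) auto
  have ev1: "eventually (\<lambda>n::nat. 1 \<le> n) sequentially" by (rule eventually_ge_at_top)
  have "filterlim \<tau> (at_right 0) sequentially"
    using \<tau>0 by (intro tendsto_imp_filterlim_at_right eventually_mono[OF ev1 \<tau>pos])
  then have ratio: "filterlim (\<lambda>n. \<omega> (\<tau> n) / \<tau> n) at_top sequentially"
    using lim by (rule filterlim_compose[rotated])
  have "(\<lambda>n. \<omega> (\<tau> n)) \<longlonglongrightarrow> \<omega> 0"
    using \<omega> by (intro continuous_on_tendsto_compose[OF _ \<tau>0])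
      (auto simp: abstract_modulus_def \<tau>_def)
  then have small: "(\<lambda>n. \<omega> (\<tau> n)) \<longlonglongrightarrow> 0"
    using \<omega> by (simp add: abstract_modulus_def)
  have next_freq: "\<exists>n'. 1 \<le> n' \<and> n < n' \<and> \<omega> (\<tau> n') \<le> \<omega> (\<tau> n) / K \<and>
      K * (\<omega> (\<tau> n) / \<tau> n) \<le> \<omega> (\<tau> n') / \<tau> n'" if n: "1 \<le> n" for n
  proof -
    have "0 < \<omega> (\<tau> n)" using abstract_modulus_pos[OF \<omega>] \<tau>pos[OF n] by blast
    then have "eventually (\<lambda>n'. \<omega> (\<tau> n') < \<omega> (\<tau> n) / K) sequentially"
      using K by (intro order_tendstoD(2)[OF small]) simp
    moreover have "eventually (\<lambda>n'. K * (\<omega> (\<tau> n) / \<tau> n) \<le> \<omega> (\<tau> n') / \<tau> n') sequentially"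
      using ratio by (simp add: filterlim_at_top)
    moreover have "eventually (\<lambda>n'. n < n') sequentially" by (rule eventually_gt_at_top)
    ultimately have "eventually (\<lambda>n'. 1 \<le> n' \<and> n < n' \<and> \<omega> (\<tau> n') \<le> \<omega> (\<tau> n) / K \<and>
        K * (\<omega> (\<tau> n) / \<tau> n) \<le> \<omega> (\<tau> n') / \<tau> n') sequentially"
      by eventually_elim auto
    then show ?thesis by (rule eventually_happens'[OF sequentially_bot])
  qed
  obtain N :: "nat \<Rightarrow> nat" where N: "\<And>k. 1 \<le> N k"
    "\<And>k. N k < N (Suc k) \<and> \<omega> (\<tau> (N (Suc k))) \<le> \<omega> (\<tau> (N k)) / K \<and>
      K * (\<omega> (\<tau> (N k)) / \<tau> (N k)) \<le> \<omega> (\<tau> (N (Suc k))) / \<tau> (N (Suc k))"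
    using dependent_nat_choice[where P = "\<lambda>_ n. 1 \<le> n" and
        Q = "\<lambda>_ n n'. n < n' \<and> \<omega> (\<tau> n') \<le> \<omega> (\<tau> n) / K \<and> K * (\<omega> (\<tau> n) / \<tau> n) \<le> \<omega> (\<tau> n') / \<tau> n'"]
      next_freq by (metis order_refl)
  have ratio_eq: "\<omega> (\<tau> n) / \<tau> n = real n ^ r * \<omega> (1 / real n ^ r)" for n
    by (simp add: \<tau>_def)
  show thesis
  proof (rule that)
    show "strict_mono N" using N(2) by (simp add: strict_mono_Suc_iff)
    show "1 \<le> N k" for k by (rule N(1))
    show "\<omega> (1 / real (N (Suc k)) ^ r) \<le> \<omega> (1 / real (N k) ^ r) / K" for k
      using N(2)[of k] unfolding \<tau>_def by blast
    show "K * (real (N k) ^ r * \<omega> (1 / real (N k) ^ r))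
        \<le> real (N (Suc k)) ^ r * \<omega> (1 / real (N (Suc k)) ^ r)" for k
      using N(2)[of k] unfolding ratio_eq by blast
  qed
qed

lemma geometric_tail_bound:
  fixes a e :: "nat \<Rightarrow> real"
  assumes "2 \<le> K" and a: "\<And>k. 0 \<le> a k" "\<And>k. a (Suc k) \<le> a k / K"
    and e: "\<And>k. m \<le> k \<Longrightarrow> \<bar>e k\<bar> \<le> C * a k" and "0 \<le> C"
  shows "summable (\<lambda>k. \<bar>e k\<bar>)" and "\<bar>\<Sum>k. e (k + m)\<bar> \<le> 2 * C * a m"
proof -
  have half: "a (k + m) \<le> a m * (1 / 2) ^ k" for k
  proof (induction k)
    case (Suc k)
    have "a (Suc k + m) \<le> a (k + m) / K" using a(2)[of "k + m"] by simp
    also have "\<dots> \<le> a (k + m) / 2" using assms(1) a(1) by (intro divide_left_mono) auto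
    finally show ?case using Suc by simp
  qed simp
  have bound: "\<bar>e (k + m)\<bar> \<le> C * a m * (1 / 2) ^ k" for k
    using e[of "k + m"] mult_left_mono[OF half \<open>0 \<le> C\<close>, of k] by (simp add: mult.assoc)
  have geo: "(\<lambda>k. C * a m * (1 / 2) ^ k) sums (C * a m * 2)"
    using sums_mult[OF geometric_sums[of "1 / 2 :: real"], of "C * a m"] by simp
  have sa: "summable (\<lambda>k. \<bar>e (k + m)\<bar>)"
    by (rule summable_comparison_test'[OF sums_summable[OF geo], of 0]) (use bound in auto)
  then show "summable (\<lambda>k. \<bar>e k\<bar>)"
    using summable_iff_shift[of "\<lambda>k. \<bar>e k\<bar>" m] by blast
  have "\<bar>\<Sum>k. e (k + m)\<bar> \<le> (\<Sum>k. \<bar>e (k + m)\<bar>)" by (rule summable_rabs[OF sa])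
  also have "\<dots> \<le> C * a m * 2"
    using suminf_le[OF bound sa sums_summable[OF geo]] sums_unique[OF geo] by simp
  finally show "\<bar>\<Sum>k. e (k + m)\<bar> \<le> 2 * C * a m" by simp
qed

text \<open>
  A sequence growing with ratio \<open>K\<close> dominates the sum of its predecessors; the factor \<open>K\<close> is kept on
  the left because the lower bound needs that sum to be small against \<open>b m\<close>, whereas the upper
  bound only needs the ratio \<open>2\<close>.
\<close>
lemma geometric_head_bound:
  fixes b :: "nat \<Rightarrow> real"
  assumes "2 \<le> K" and b: "\<And>k. 0 \<le> b k" "\<And>k. K * b k \<le> b (Suc k)"
  shows "K * (\<Sum>k<m. b k) \<le> 2 * b m"
proof (induction m)
  case (Suc m)
  have "2 * (\<Sum>k<m. b k) \<le> K * (\<Sum>k<m. b k)"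
    using assms(1) b by (intro mult_right_mono sum_nonneg)
  then have "(\<Sum>k<Suc m. b k) \<le> 2 * b m" using Suc by simp
  then have "K * (\<Sum>k<Suc m. b k) \<le> K * (2 * b m)" using assms(1) by (intro mult_left_mono) auto
  also have "\<dots> \<le> 2 * b (Suc m)" using b(2)[of m] by simp
  finally show ?case .
qed (use b in simp)

text \<open>
  The frequencies carry a factor \<open>M\<close> because a network with \<open>n\<close> units is tested on \<open>M * n\<close> subintervals,
  each holding two periods of the sine.
\<close>
locale lacunary_sine_series =
  fixes r :: nat and K :: real and M :: nat and N :: "nat \<Rightarrow> nat" and a :: "nat \<Rightarrow> real"
  assumes r: "1 \<le> r" and M: "1 \<le> M" and K: "2 \<le> K"
    and N: "strict_mono N" "\<And>k. 1 \<le> N k"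
    and a_nonneg: "\<And>k. 0 \<le> a k"
    and a_decay: "\<And>k. a (Suc k) \<le> a k / K"
    and b_growth: "\<And>k. K * (real (N k) ^ r * a k) \<le> real (N (Suc k)) ^ r * a (Suc k)"
begin

definition series :: "real \<Rightarrow> real" where
  "series x = (\<Sum>k. a k * sin (4 * pi * real (M * N k) * x))"

definition diff_term :: "real \<Rightarrow> real \<Rightarrow> nat \<Rightarrow> real" where
  "diff_term h x k = a k * fwd_diff r h (\<lambda>x. sin (4 * pi * real (M * N k) * x)) x"

lemma abs_diff_term_le:
  "\<bar>diff_term h x k\<bar> \<le> 2 ^ r * a k"
  "0 \<le> h \<Longrightarrow> \<bar>diff_term h x k\<bar> \<le> (4 * pi * real M * h) ^ r * (real (N k) ^ r * a k)"
proof -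
  have "\<bar>fwd_diff r h (\<lambda>x. sin (4 * pi * real (M * N k) * x)) x\<bar> \<le> 2 ^ r * 1"
    by (rule abs_fwd_diff_bounded) simp
  then show "\<bar>diff_term h x k\<bar> \<le> 2 ^ r * a k"
    using mult_left_mono[OF _ a_nonneg[of k]] a_nonneg[of k]
    by (fastforce simp: diff_term_def abs_mult mult.commute)
  assume "0 \<le> h"
  then have "\<bar>fwd_diff r h (\<lambda>x. sin (4 * pi * real (M * N k) * x)) x\<bar> \<le> (4 * pi * real (M * N k) * h) ^ r"
    by (intro abs_fwd_diff_sin_le) auto
  then have "a k * \<bar>fwd_diff r h (\<lambda>x. sin (4 * pi * real (M * N k) * x)) x\<bar>
      \<le> a k * (4 * pi * real (M * N k) * h) ^ r"
    by (rule mult_left_mono) (rule a_nonneg)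
  also have "\<dots> = (4 * pi * real M * h) ^ r * (real (N k) ^ r * a k)"
    by (simp add: power_mult_distrib)
  finally show "\<bar>diff_term h x k\<bar> \<le> (4 * pi * real M * h) ^ r * (real (N k) ^ r * a k)"
    using a_nonneg[of k] by (simp add: diff_term_def abs_mult)
qed

lemma summable_a: "summable a"
  using geometric_tail_bound(1)[OF K, of a 0 a 1] a_nonneg a_decay by simp

lemma abs_term_le: "\<bar>a k * sin y\<bar> \<le> a k"
  using mult_left_mono[OF abs_sin_le_one[of y] a_nonneg[of k]] a_nonneg[of k] by (simp add: abs_mult)

lemma summable_series: "summable (\<lambda>k. a k * sin (4 * pi * real (M * N k) * x))"
  by (rule summable_comparison_test'[OF summable_a, of 0]) (use abs_term_le in simp)

lemma continuous_series: "continuous_on UNIV series"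
proof (rule uniform_limit_theorem)
  show "uniform_limit UNIV (\<lambda>n x. \<Sum>k<n. a k * sin (4 * pi * real (M * N k) * x)) series sequentially"
    unfolding series_def
    by (rule Weierstrass_m_test[OF _ summable_a]) (use abs_term_le in simp)
qed (auto intro!: always_eventually continuous_intros)

lemma diff_term_sums: "(\<lambda>k. diff_term h x k) sums fwd_diff r h series x"
  using fwd_diff_suminf[OF summable_series, where r = r and h = h and x = x]
  by (simp add: diff_term_def fwd_diff_scale series_def[abs_def])

lemma fwd_diff_series_split:
  "fwd_diff r h series x = (\<Sum>k. diff_term h x (k + m)) + (\<Sum>k<m. diff_term h x k)"
  using suminf_split_initial_segment[OF sums_summable[OF diff_term_sums], of h x m]
    sums_unique[OF diff_term_sums, of h x] by simp

text \<open>
  The series is split at the first index \<open>m\<close> with \<open>N m * h \<ge> 1\<close>. From \<open>m\<close> on, the trivial bound by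
  \<open>a k\<close> is summed; since \<open>1 / N m ^ r \<le> h ^ r\<close>, monotonicity gives \<open>a m \<le> \<omega> (h ^ r)\<close>. Before \<open>m\<close>, the
  bound by \<open>h ^ r * N k ^ r * a k\<close> is summed, and its last term is at most \<open>2 * \<omega> (h ^ r)\<close> by
  \<open>abstract_modulus_ratio\<close>.
\<close>
lemma abs_fwd_diff_series_le:
  assumes \<omega>: "abstract_modulus \<omega>" and a: "\<And>k. a k = \<omega> (1 / real (N k) ^ r)" and "0 < h"
  shows "\<bar>fwd_diff r h series x\<bar> \<le> 6 * (4 * pi * real M) ^ r * \<omega> (h ^ r)"
proof -
  define C where "C = (4 * pi * real M) ^ r"
  have C: "0 \<le> C" "2 ^ r \<le> C"
  proof -
    have "2 * 1 \<le> (4 * pi) * real M" using M pi_gt3 by (intro mult_mono) auto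
    then show "2 ^ r \<le> C" unfolding C_def by (intro power_mono) auto
  qed (simp add: C_def)
  have "\<exists>m. 1 \<le> real (N m) * h"
  proof -
    obtain m :: nat where "1 / h \<le> real m" using real_arch_simple by blast
    moreover have "real m \<le> real (N m)" using strict_mono_imp_increasing[OF N(1)] by simp
    ultimately have "1 / h \<le> real (N m)" by linarith
    then show ?thesis using \<open>0 < h\<close> by (auto simp: field_simps)
  qed
  then obtain m where m: "1 \<le> real (N m) * h" and least: "\<And>k. k < m \<Longrightarrow> real (N k) * h < 1"
    using exists_least_iff[of "\<lambda>m. 1 \<le> real (N m) * h"] by (auto simp: not_le)
  have \<omega>h: "0 < \<omega> (h ^ r)" using abstract_modulus_pos[OF \<omega>] \<open>0 < h\<close> by simp
  have am: "a m \<le> \<omega> (h ^ r)"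
    unfolding a
  proof (rule mono_onD[where f = \<omega> and A = "{0..}"])
    show "mono_on {0..} \<omega>" using \<omega> by (simp add: abstract_modulus_def)
    have "1 \<le> (real (N m) * h) ^ r" using m by (rule one_le_power)
    then show "1 / real (N m) ^ r \<le> h ^ r"
      using N(2)[of m] by (simp add: power_mult_distrib field_simps)
  qed (use \<open>0 < h\<close> in auto)
  have "\<bar>diff_term h x k\<bar> \<le> C * a k" for k
    using abs_diff_term_le(1)[of h x k] mult_right_mono[OF C(2) a_nonneg[of k]] by linarith
  then have "\<bar>\<Sum>k. diff_term h x (k + m)\<bar> \<le> 2 * C * a m"
    by (intro geometric_tail_bound(2)[OF K]) (use a_nonneg a_decay C in auto)
  also have "\<dots> \<le> 2 * C * \<omega> (h ^ r)" using am C by (intro mult_left_mono) auto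
  finally have tail: "\<bar>\<Sum>k. diff_term h x (k + m)\<bar> \<le> 2 * C * \<omega> (h ^ r)" .
  have head: "\<bar>\<Sum>k<m. diff_term h x k\<bar> \<le> 4 * C * \<omega> (h ^ r)"
  proof (cases m)
    case 0
    then show ?thesis using C \<omega>h by simp
  next
    case (Suc l)
    have "\<bar>\<Sum>k<m. diff_term h x k\<bar> \<le> (\<Sum>k<m. \<bar>diff_term h x k\<bar>)" by (rule sum_abs)
    also have "\<dots> \<le> (\<Sum>k<m. C * h ^ r * (real (N k) ^ r * a k))"
      using abs_diff_term_le(2)[of h x] \<open>0 < h\<close>
      by (intro sum_mono) (simp add: C_def power_mult_distrib)
    also have "\<dots> = C * h ^ r * (\<Sum>k<m. real (N k) ^ r * a k)" by (simp add: sum_distrib_left)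
    also have "\<dots> \<le> C * h ^ r * (2 * (real (N l) ^ r * a l))"
    proof (rule mult_left_mono)
      have "2 * (\<Sum>k<l. real (N k) ^ r * a k) \<le> K * (\<Sum>k<l. real (N k) ^ r * a k)"
        using K a_nonneg by (intro mult_right_mono sum_nonneg) auto
      also have "\<dots> \<le> 2 * (real (N l) ^ r * a l)"
        by (rule geometric_head_bound[OF K]) (use a_nonneg b_growth in auto)
      finally show "(\<Sum>k<m. real (N k) ^ r * a k) \<le> 2 * (real (N l) ^ r * a l)"
        by (simp add: Suc mult.commute)
    qed (use C \<open>0 < h\<close> in auto)
    also have "\<dots> = 2 * C * (real (N l) ^ r * (h ^ r * a l))" by simp
    also have "\<dots> \<le> 2 * C * (2 * \<omega> (h ^ r))"
    proof (rule mult_left_mono)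
      have "(real (N l) * h) ^ r \<le> 1"
        using least[of l] \<open>0 < h\<close> Suc by (intro power_le_one) auto
      then have "h ^ r \<le> 1 / real (N l) ^ r"
        using N(2)[of l] by (simp add: power_mult_distrib field_simps)
      then have "h ^ r * a l \<le> 2 * (1 / real (N l) ^ r) * \<omega> (h ^ r)"
        unfolding a using \<open>0 < h\<close> by (intro abstract_modulus_ratio[OF \<omega>]) auto
      then have "real (N l) ^ r * (h ^ r * a l)
          \<le> real (N l) ^ r * (2 * (1 / real (N l) ^ r) * \<omega> (h ^ r))"
        by (rule mult_left_mono) simp
      then show "real (N l) ^ r * (h ^ r * a l) \<le> 2 * \<omega> (h ^ r)"
        using N(2)[of l] by simp
    qed (use C in auto)
    finally show ?thesis by simp
  qed
  show ?thesis
    using fwd_diff_series_split[of h x m] tail head unfolding C_def[symmetric] by linarith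
qed

text \<open>
  At the step belonging to \<open>N k\<close>, later summands are small by the decay of \<open>a\<close> and earlier ones by the growth of
  \<open>N k ^ r * a k\<close>; each part gains the factor \<open>1 / K\<close>. The argument of the power in the second part is
  at most \<open>pi / r \<le> 4\<close>, hence the constant \<open>4 ^ r\<close>.
\<close>
lemma abs_fwd_diff_rest_le:
  assumes "h = 1 / (4 * real r * real (M * N k))" and "32 * 4 ^ r \<le> A * K"
  shows "\<bar>fwd_diff r h (\<lambda>x. series x - a k * sin (4 * pi * real (M * N k) * x)) x\<bar> \<le> A * a k / 8"
proof -
  have "\<bar>\<Sum>j. diff_term h x (j + Suc k)\<bar> \<le> 2 * 2 ^ r * a (Suc k)"
    by (rule geometric_tail_bound(2)[OF K, where a = a]) (use a_nonneg a_decay abs_diff_term_le(1) in auto)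
  also have "\<dots> \<le> 2 * 4 ^ r * (a k / K)"
    using a_decay[of k] a_nonneg[of "Suc k"] by (intro mult_mono power_mono) auto
  finally have tail: "\<bar>\<Sum>j. diff_term h x (j + Suc k)\<bar> \<le> 2 * 4 ^ r * (a k / K)" .
  have h0: "0 \<le> h" using assms by simp
  have "4 * pi * real M * h \<le> 4 / real (N k)"
  proof -
    have "4 * pi * real M * h = (pi / real r) / real (N k)" using M by (simp add: assms(1))
    also have "\<dots> \<le> 4 / real (N k)"
      using r pi_less_4 by (intro divide_right_mono) (auto simp: field_simps)
    finally show ?thesis .
  qed
  then have step: "(4 * pi * real M * h) ^ r \<le> (4 / real (N k)) ^ r"
    using h0 by (intro power_mono) auto
  have "\<bar>\<Sum>j<k. diff_term h x j\<bar> \<le> (\<Sum>j<k. \<bar>diff_term h x j\<bar>)" by (rule sum_abs)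
  also have "\<dots> \<le> (\<Sum>j<k. (4 / real (N k)) ^ r * (real (N j) ^ r * a j))"
    using a_nonneg
    by (intro sum_mono order_trans[OF abs_diff_term_le(2)[OF h0] mult_right_mono[OF step]]) auto
  also have "\<dots> = (4 / real (N k)) ^ r * (\<Sum>j<k. real (N j) ^ r * a j)" by (simp add: sum_distrib_left)
  also have "\<dots> \<le> (4 / real (N k)) ^ r * (2 * (real (N k) ^ r * a k) / K)"
  proof (rule mult_left_mono)
    have "K * (\<Sum>j<k. real (N j) ^ r * a j) \<le> 2 * (real (N k) ^ r * a k)"
      by (rule geometric_head_bound[OF K]) (use a_nonneg b_growth in auto)
    then show "(\<Sum>j<k. real (N j) ^ r * a j) \<le> 2 * (real (N k) ^ r * a k) / K"
      using K by (simp add: field_simps)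
  qed simp
  also have "\<dots> = 2 * 4 ^ r * (a k / K)"
    using N(2)[of k] by (simp add: power_divide)
  finally have head: "\<bar>\<Sum>j<k. diff_term h x j\<bar> \<le> 2 * 4 ^ r * (a k / K)" .
  have "fwd_diff r h (\<lambda>x. series x - a k * sin (4 * pi * real (M * N k) * x)) x
      = (\<Sum>j. diff_term h x (j + Suc k)) + (\<Sum>j<k. diff_term h x j)"
    unfolding fwd_diff_diff fwd_diff_scale fwd_diff_series_split[of h x "Suc k"]
    by (simp add: diff_term_def)
  then have "\<bar>fwd_diff r h (\<lambda>x. series x - a k * sin (4 * pi * real (M * N k) * x)) x\<bar>
      \<le> 4 * 4 ^ r * (a k / K)"
    using tail head by linarith
  also have "\<dots> = 32 * 4 ^ r * (a k / (8 * K))" by simp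
  also have "\<dots> \<le> A * K * (a k / (8 * K))"
    using assms(2) K a_nonneg[of k] by (intro mult_right_mono) auto
  also have "\<dots> = A * a k / 8" using K by simp
  finally show ?thesis .
qed

end

lemma continuous_network:
  "continuous_on UNIV (\<lambda>x. \<Sum>k=1..n. a k * sigma_a (b k * x + c k))"
  unfolding sigma_a_def by (intro continuous_intros)

lemma (in lacunary_sine_series) best_approx_series_lower:
  assumes "M = 4 * r" and A: "A = (2 * sin (pi / (2 * real r))) ^ r"
    and "32 * 4 ^ r \<le> A * K" and p: "1 \<le> p"
  shows "A * a k / (32 * 2 ^ r) \<le> best_approx (Phi (N k) sigma_a) series p"
  unfolding best_approx_def
proof (rule cINF_greatest)
  have "(\<lambda>x. \<Sum>j=1..N k. 0 * sigma_a (0 * x + 0)) \<in> Phi (N k) sigma_a"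
    unfolding Phi_def by (intro CollectI exI[of _ "\<lambda>_. 0"] ballI refl)
  then show "Phi (N k) sigma_a \<noteq> {}" by blast
  fix g assume "g \<in> Phi (N k) sigma_a"
  then obtain \<alpha> \<beta> \<gamma> :: "nat \<Rightarrow> real"
    where g: "\<And>x. x \<in> {0..1} \<Longrightarrow> g x = (\<Sum>j=1..N k. \<alpha> j * sigma_a (\<beta> j * x + \<gamma> j))"
    unfolding Phi_def by blast
  define G where "G x = (\<Sum>j=1..N k. \<alpha> j * sigma_a (\<beta> j * x + \<gamma> j))" for x
  define h where "h = 1 / (4 * real r * real (M * N k))"
  define R where "R x = series x - a k * sin (4 * pi * real (M * N k) * x)" for x
  have "A * a k / 32 \<le> 2 ^ r * integral {0..1}
      (\<lambda>x. \<bar>a k * sin (4 * pi * real (M * N k) * x) + R x - G x\<bar>)"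
    unfolding G_def
  proof (rule network_error_lower_bound[OF r N(2) _ h_def A])
    show "continuous_on UNIV R"
      unfolding R_def by (intro continuous_intros continuous_series)
    show "\<bar>fwd_diff r h R x\<bar> \<le> A * a k / 8" for x
      unfolding R_def by (rule abs_fwd_diff_rest_le[OF h_def assms(3)])
  qed (use assms(1) a_nonneg in auto)
  also have "(\<lambda>x. \<bar>a k * sin (4 * pi * real (M * N k) * x) + R x - G x\<bar>) = (\<lambda>x. \<bar>series x - G x\<bar>)"
    by (simp add: R_def)
  also have "integral {0..1} (\<lambda>x. \<bar>series x - G x\<bar>) \<le> X_norm p (\<lambda>x. series x - G x)"
    unfolding G_def
    by (intro integral_abs_le_X_norm[OF _ p] continuous_on_diff continuous_series continuous_network)
  also have "X_norm p (\<lambda>x. series x - G x) = X_norm p (\<lambda>x. series x - g x)"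
    by (rule X_norm_cong) (simp add: g G_def)
  finally show "A * a k / (32 * 2 ^ r) \<le> X_norm p (\<lambda>x. series x - g x)"
    by (simp add: field_simps)
qed

section \<open>Sharpness of the approximation rate\<close>

theorem corollary4p2:
  fixes r :: nat and p :: ennreal and \<omega> :: "real \<Rightarrow> real"
  assumes "r \<ge> 1" and "1 \<le> p"
    and "abstract_modulus \<omega>"
    and "filterlim (\<lambda>\<delta>. \<omega> \<delta> / \<delta>) at_top (at_right 0)"
  shows "\<exists>f \<in> X_space p.
           (\<lambda>\<delta>. smoothness_modulus r f \<delta> p) \<in> O[at_right 0](\<lambda>\<delta>. \<omega> (\<delta> ^ r)) \<and>
           (\<lambda>n::nat. best_approx (Phi n sigma_a) f p) \<notin> o(\<lambda>n. \<omega> (1 / real n ^ r))"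
proof -
  define A where "A = (2 * sin (pi / (2 * real r))) ^ r"
  have A: "0 < A"
    unfolding A_def using assms(1)
    by (intro zero_less_power mult_pos_pos sin_gt_zero) (auto simp: field_simps)
  \<comment> \<open>Large enough to make the rest of the series negligible in \<open>abs_fwd_diff_rest_le\<close>.\<close>
  define K where "K = 2 + 32 * 4 ^ r / A"
  have K_bounds: "2 \<le> K" "32 * 4 ^ r \<le> A * K" using A by (auto simp: K_def field_simps)
  obtain N where N: "strict_mono N" "\<And>k. 1 \<le> N k"
    "\<And>k. \<omega> (1 / real (N (Suc k)) ^ r) \<le> \<omega> (1 / real (N k) ^ r) / K"
    "\<And>k. K * (real (N k) ^ r * \<omega> (1 / real (N k) ^ r))
          \<le> real (N (Suc k)) ^ r * \<omega> (1 / real (N (Suc k)) ^ r)"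
    using lacunary_frequencies[OF assms(3,4,1), of K] K_bounds by auto
  define a where "a k = \<omega> (1 / real (N k) ^ r)" for k
  have a_pos: "0 < a k" for k
    using abstract_modulus_pos[OF assms(3)] N(2)[of k] by (simp add: a_def)
  interpret lacunary_sine_series r K "4 * r" N a
    using assms(1) K_bounds N a_pos by unfold_locales (auto simp: a_def less_imp_le)
  define C where "C = 6 * (4 * pi * real (4 * r)) ^ r"
  have C: "0 \<le> C" by (simp add: C_def)
  have up: "norm (smoothness_modulus r series \<delta> p) \<le> C * norm (\<omega> (\<delta> ^ r))" if "0 < \<delta>" for \<delta>
  proof -
    have pos: "0 < \<omega> (\<delta> ^ r)" using abstract_modulus_pos[OF assms(3)] that by simp
    have "\<bar>fwd_diff r h series x\<bar> \<le> C * \<omega> (\<delta> ^ r)" if h: "0 < h" "h \<le> \<delta>" for h x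
    proof -
      have "\<omega> (h ^ r) \<le> \<omega> (\<delta> ^ r)"
        using assms(3) h by (intro mono_onD[where f = \<omega> and A = "{0..}"] power_mono)
          (auto simp: abstract_modulus_def)
      then show ?thesis
        using abs_fwd_diff_series_le[OF assms(3) a_def h(1), of x] mult_left_mono[OF _ C]
        unfolding C_def by (meson order_trans)
    qed
    from smoothness_modulus_bounds[OF assms(1,2) that this] pos show ?thesis by simp
  qed
  have "(\<lambda>\<delta>. smoothness_modulus r series \<delta> p) \<in> O[at_right 0](\<lambda>\<delta>. \<omega> (\<delta> ^ r))"
    by (rule bigoI[where c = C]) (use up in \<open>auto simp: eventually_at_filter intro!: always_eventually\<close>)
  moreover have "(\<lambda>n::nat. best_approx (Phi n sigma_a) series p) \<notin> o(\<lambda>n. \<omega> (1 / real n ^ r))"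
  proof
    define c where "c = A / (32 * 2 ^ r)"
    have c: "0 < c" using A by (simp add: c_def)
    assume "(\<lambda>n::nat. best_approx (Phi n sigma_a) series p) \<in> o(\<lambda>n. \<omega> (1 / real n ^ r))"
    from landau_o.smallD[OF this, of "c / 2"] c obtain n0
      where n0: "\<And>n. n0 \<le> n \<Longrightarrow> norm (best_approx (Phi n sigma_a) series p)
          \<le> c / 2 * norm (\<omega> (1 / real n ^ r))"
      by (auto simp: eventually_sequentially)
    have "n0 \<le> N n0" using strict_mono_imp_increasing[OF N(1)] by simp
    then have "best_approx (Phi (N n0) sigma_a) series p \<le> c / 2 * a n0"
      using n0[of "N n0"] a_pos[of n0] by (simp add: a_def)
    moreover have "c * a n0 \<le> best_approx (Phi (N n0) sigma_a) series p"
      using best_approx_series_lower[OF refl A_def K_bounds(2) assms(2), of n0] by (simp add: c_def)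
    moreover have "0 < c * a n0" using c a_pos by simp
    ultimately show False by simp
  qed
  ultimately show ?thesis using continuous_in_X_space[OF continuous_series assms(2)] by blast
qed

end
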